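(* Let $X$ be a locally ringed space and $R=\mathscr{O}_X(X)$. Then the map $\mathscr{B}(R)\to\operatorname{Clop}(X)$ given by $s\mapsto X_s$ is an isomorphism of Boolean rings.
   Context: All rings are commutative. For a ring $R$, $\mathscr{B}(R)=\{e\in R: e=e^2\}$ is the Boolean ring of idempotents of $R$, with addition $e\oplus e'=e+e'-2ee'$ and multiplication $e\cdot e'=ee'$. For a topological space $X$, $\operatorname{Clop}(X)$ is the Boolean ring of all clopen (both open and closed) subsets of $X$, with addition $A+B=(A\cup B)\setminus(A\cap B)$ and multiplication $A\cdot B=A\cap B$. For a locally ringed space $X$ and $s\in\mathscr{O}_X(X)$, $X_s=\{x\in X: s_x\notin\mathfrak{m}_x\}$, where $s_x$ is the germ of $s$ at $x$ and $\mathfrak{m}_x$ is the maximal ideal of the local ring $\mathscr{O}_{X,x}$. *)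

theory Defs
  imports "HOL-Analysis.Abstract_Topology" "HOL-Algebra.QuotRing"
begin

section \<open>Boolean rings\<close>

locale boolean_ring = ring R for R (structure) +
  assumes mult_idem: "x \<in> carrier R \<Longrightarrow> x \<otimes> x = x"

definition idempotent_ring :: "'a ring \<Rightarrow> 'a ring" where
  "idempotent_ring R =
    \<lparr>carrier = {e \<in> carrier R. e = e \<otimes>\<^bsub>R\<^esub> e},
     mult = (\<lambda>e e'. e \<otimes>\<^bsub>R\<^esub> e'),
     one = \<one>\<^bsub>R\<^esub>,
     zero = \<zero>\<^bsub>R\<^esub>,
     add = (\<lambda>e e'. (e \<oplus>\<^bsub>R\<^esub> e') \<ominus>\<^bsub>R\<^esub> ([(2::nat)] \<cdot>\<^bsub>R\<^esub> (e \<otimes>\<^bsub>R\<^esub> e')))\<rparr>"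

definition clopen_ring :: "'x topology \<Rightarrow> 'x set ring" where
  "clopen_ring X =
    \<lparr>carrier = {A. openin X A \<and> closedin X A},
     mult = (\<lambda>A B. A \<inter> B),
     one = topspace X,
     zero = {},
     add = (\<lambda>A B. (A \<union> B) - (A \<inter> B))\<rparr>"

lemma boolean_ring_idempotent_ring:
  fixes R :: "'a ring"
  assumes "cring R"
  shows "boolean_ring (idempotent_ring R)"
proof -
  interpret cring R by fact
  define d where "d e f = (e \<oplus>\<^bsub>R\<^esub> f) \<ominus>\<^bsub>R\<^esub> ([(2::nat)] \<cdot>\<^bsub>R\<^esub> (e \<otimes>\<^bsub>R\<^esub> f))" for e f
  have d: "d e f = (e \<oplus>\<^bsub>R\<^esub> f) \<ominus>\<^bsub>R\<^esub> (e \<otimes>\<^bsub>R\<^esub> f \<oplus>\<^bsub>R\<^esub> e \<otimes>\<^bsub>R\<^esub> f)"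
    if "e \<in> carrier R" "f \<in> carrier R" for e f
    using that by (simp add: d_def numeral_2_eq_2 add.nat_pow_Suc)
  have closed: "d e f \<in> carrier R" if "e \<in> carrier R" "f \<in> carrier R" for e f
    using that by (simp add: d)
  have comm: "d e f = d f e" if "e \<in> carrier R" "f \<in> carrier R" for e f
    using that by (simp add: d m_comm a_comm)
  have zero: "d \<zero>\<^bsub>R\<^esub> e = e" if "e \<in> carrier R" for e
    using that by (simp add: d a_minus_def)
  have self: "d e e = \<zero>\<^bsub>R\<^esub>" if "e \<in> carrier R" "e \<otimes>\<^bsub>R\<^esub> e = e" for e
    using that by (simp add: d a_minus_def r_neg)
  have distr: "d e f \<otimes>\<^bsub>R\<^esub> g = d (e \<otimes>\<^bsub>R\<^esub> g) (f \<otimes>\<^bsub>R\<^esub> g)"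
    if "e \<in> carrier R" "f \<in> carrier R" "g \<in> carrier R" "g \<otimes>\<^bsub>R\<^esub> g = g" for e f g
  proof -
    have "e \<otimes>\<^bsub>R\<^esub> g \<otimes>\<^bsub>R\<^esub> (f \<otimes>\<^bsub>R\<^esub> g) = e \<otimes>\<^bsub>R\<^esub> f \<otimes>\<^bsub>R\<^esub> (g \<otimes>\<^bsub>R\<^esub> g)"
      using that(1-3) by (simp add: m_ac)
    then have "e \<otimes>\<^bsub>R\<^esub> g \<otimes>\<^bsub>R\<^esub> (f \<otimes>\<^bsub>R\<^esub> g) = e \<otimes>\<^bsub>R\<^esub> f \<otimes>\<^bsub>R\<^esub> g" using that by simp
    then show ?thesis using that(1-3)
      by (simp add: d a_minus_def l_distr l_minus minus_add)
  qed
  have assoc: "d (d e f) g = d e (d f g)"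
    if "e \<in> carrier R" "f \<in> carrier R" "g \<in> carrier R" for e f g
    using that by (simp add: d a_minus_def l_distr r_distr l_minus r_minus minus_add a_ac m_ac)
  have idem: "d e f \<otimes>\<^bsub>R\<^esub> d e f = d e f"
    if "e \<in> carrier R" "f \<in> carrier R" "e \<otimes>\<^bsub>R\<^esub> e = e" "f \<otimes>\<^bsub>R\<^esub> f = f" for e f
  proof -
    have ef: "e \<otimes>\<^bsub>R\<^esub> f \<in> carrier R" using that by simp
    have 1: "d e f \<otimes>\<^bsub>R\<^esub> e = e \<ominus>\<^bsub>R\<^esub> e \<otimes>\<^bsub>R\<^esub> f"
    proof -
      have "d e f \<otimes>\<^bsub>R\<^esub> e = d e (f \<otimes>\<^bsub>R\<^esub> e)" using that by (simp add: distr)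
      also have "\<dots> = d e (e \<otimes>\<^bsub>R\<^esub> f)" using that by (simp add: m_comm)
      also have "\<dots> = (e \<oplus>\<^bsub>R\<^esub> e \<otimes>\<^bsub>R\<^esub> f) \<ominus>\<^bsub>R\<^esub> (e \<otimes>\<^bsub>R\<^esub> f \<oplus>\<^bsub>R\<^esub> e \<otimes>\<^bsub>R\<^esub> f)"
        using that by (simp add: d m_assoc[symmetric])
      also have "\<dots> = e \<ominus>\<^bsub>R\<^esub> e \<otimes>\<^bsub>R\<^esub> f"
        using that(1) ef by (simp add: a_minus_def minus_add a_assoc r_neg1 r_neg2)
      finally show ?thesis .
    qed
    have 2: "d e f \<otimes>\<^bsub>R\<^esub> f = f \<ominus>\<^bsub>R\<^esub> e \<otimes>\<^bsub>R\<^esub> f"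
    proof -
      have "d e f \<otimes>\<^bsub>R\<^esub> f = d (e \<otimes>\<^bsub>R\<^esub> f) f" using that by (simp add: distr)
      also have "\<dots> = (f \<oplus>\<^bsub>R\<^esub> e \<otimes>\<^bsub>R\<^esub> f) \<ominus>\<^bsub>R\<^esub> (e \<otimes>\<^bsub>R\<^esub> f \<oplus>\<^bsub>R\<^esub> e \<otimes>\<^bsub>R\<^esub> f)"
        using that by (simp add: d m_assoc a_comm)
      also have "\<dots> = f \<ominus>\<^bsub>R\<^esub> e \<otimes>\<^bsub>R\<^esub> f"
        using that(2) ef by (simp add: a_minus_def minus_add a_assoc r_neg1 r_neg2)
      finally show ?thesis .
    qed
    have "d e f \<otimes>\<^bsub>R\<^esub> (e \<otimes>\<^bsub>R\<^esub> f) = (d e f \<otimes>\<^bsub>R\<^esub> e) \<otimes>\<^bsub>R\<^esub> f"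
      using that closed by (simp add: m_assoc)
    also have "\<dots> = \<zero>\<^bsub>R\<^esub>"
      using that ef by (simp add: 1 a_minus_def l_distr l_minus m_assoc r_neg)
    finally have 3: "d e f \<otimes>\<^bsub>R\<^esub> (e \<otimes>\<^bsub>R\<^esub> f) = \<zero>\<^bsub>R\<^esub>" .
    have "d e f \<otimes>\<^bsub>R\<^esub> d e f = d e f \<otimes>\<^bsub>R\<^esub> e \<oplus>\<^bsub>R\<^esub> d e f \<otimes>\<^bsub>R\<^esub> f"
      using that closed[of e f] 3 by (subst (2) d) (simp_all add: a_minus_def r_distr r_minus)
    also have "\<dots> = d e f"
      unfolding 1 2 using that(1,2) ef by (simp add: d a_minus_def minus_add a_ac)
    finally show ?thesis .
  qed
  have mult: "(e \<otimes>\<^bsub>R\<^esub> f) \<otimes>\<^bsub>R\<^esub> (e \<otimes>\<^bsub>R\<^esub> f) = e \<otimes>\<^bsub>R\<^esub> f"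
    if "e \<in> carrier R" "f \<in> carrier R" "e \<otimes>\<^bsub>R\<^esub> e = e" "f \<otimes>\<^bsub>R\<^esub> f = f" for e f
  proof -
    have "(e \<otimes>\<^bsub>R\<^esub> f) \<otimes>\<^bsub>R\<^esub> (e \<otimes>\<^bsub>R\<^esub> f) = (e \<otimes>\<^bsub>R\<^esub> e) \<otimes>\<^bsub>R\<^esub> (f \<otimes>\<^bsub>R\<^esub> f)"
      using that(1,2) by (simp add: m_ac)
    then show ?thesis using that by simp
  qed
  have ops: "carrier (idempotent_ring R) = {e \<in> carrier R. e \<otimes>\<^bsub>R\<^esub> e = e}"
    "mult (idempotent_ring R) = mult R" "one (idempotent_ring R) = \<one>\<^bsub>R\<^esub>"
    "zero (idempotent_ring R) = \<zero>\<^bsub>R\<^esub>" "add (idempotent_ring R) = d"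
    by (auto simp: idempotent_ring_def d_def fun_eq_iff)
  have "abelian_group (idempotent_ring R)"
  proof (rule abelian_groupI)
    fix e f
    assume "e \<in> carrier (idempotent_ring R)" "f \<in> carrier (idempotent_ring R)"
    then show "e \<oplus>\<^bsub>idempotent_ring R\<^esub> f = f \<oplus>\<^bsub>idempotent_ring R\<^esub> e"
      by (simp add: ops comm)
  qed (use self in \<open>auto simp: ops closed idem zero assoc\<close>)
  moreover have "monoid (idempotent_ring R)"
    by (rule monoidI) (auto simp: ops mult intro: m_assoc)
  ultimately have "ring (idempotent_ring R)"
  proof (rule ringI)
    fix e f g
    assume "e \<in> carrier (idempotent_ring R)" "f \<in> carrier (idempotent_ring R)"
      "g \<in> carrier (idempotent_ring R)"
    then show "g \<otimes>\<^bsub>idempotent_ring R\<^esub> (e \<oplus>\<^bsub>idempotent_ring R\<^esub> f)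
      = g \<otimes>\<^bsub>idempotent_ring R\<^esub> e \<oplus>\<^bsub>idempotent_ring R\<^esub> g \<otimes>\<^bsub>idempotent_ring R\<^esub> f"
      using distr[of e f g] by (simp add: ops m_comm closed)
  qed (auto simp: ops distr)
  then show ?thesis
    by (auto simp: boolean_ring_def boolean_ring_axioms_def ops)
qed

lemma boolean_ring_clopen_ring: "boolean_ring (clopen_ring X)"
proof -
  have closed: "openin X ((A \<union> B) - (A \<inter> B)) \<and> closedin X ((A \<union> B) - (A \<inter> B))"
    if "openin X A" "closedin X A" "openin X B" "closedin X B" for A B
  proof -
    have "(A \<union> B) - (A \<inter> B) = (A - B) \<union> (B - A)" by auto
    then show ?thesis using that by auto
  qed
  have sub: "A \<subseteq> topspace X" if "openin X A" for A
    using that by (rule openin_subset)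
  have "abelian_group (clopen_ring X)"
    by (rule abelian_groupI) (auto simp: clopen_ring_def closed)
  moreover have "monoid (clopen_ring X)"
    by (rule monoidI) (use sub in \<open>auto simp: clopen_ring_def\<close>)
  ultimately have "ring (clopen_ring X)"
    by (rule ringI) (auto simp: clopen_ring_def)
  then show ?thesis
    by (auto simp: boolean_ring_def boolean_ring_axioms_def clopen_ring_def)
qed
section \<open>Ringed spaces\<close>

text \<open>
  A space is an abstract topology \<open>X\<close>; its points are \<open>topspace X\<close>. The sections over all open
  sets live in one type \<open>'a\<close>, but the rings \<open>\<O> U\<close> have independent carriers and operations, so
  this is no restriction up to isomorphism. \<open>res U V\<close> is the restriction from \<open>U\<close> to \<open>V\<close>. The
  values of \<open>\<O>\<close> and \<open>res\<close> at sets that are not open are irrelevant. Covers are sets of open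
  sets; the empty cover is allowed, so \<open>\<O> {}\<close> is the zero ring.
\<close>

locale ringed_space =
  fixes X :: "'x topology"
    and \<O> :: "'x set \<Rightarrow> 'a ring"
    and res :: "'x set \<Rightarrow> 'x set \<Rightarrow> 'a \<Rightarrow> 'a"
  assumes cring_sections: "openin X U \<Longrightarrow> cring (\<O> U)"
    and res_hom: "\<lbrakk>openin X U; openin X V; V \<subseteq> U\<rbrakk> \<Longrightarrow> res U V \<in> ring_hom (\<O> U) (\<O> V)"
    and res_id: "\<lbrakk>openin X U; s \<in> carrier (\<O> U)\<rbrakk> \<Longrightarrow> res U U s = s"
    and res_res: "\<lbrakk>openin X U; openin X V; openin X W; W \<subseteq> V; V \<subseteq> U; s \<in> carrier (\<O> U)\<rbrakk>
      \<Longrightarrow> res V W (res U V s) = res U W s"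
    and locality: "\<lbrakk>\<And>V. V \<in> \<U> \<Longrightarrow> openin X V;
        s \<in> carrier (\<O> (\<Union>\<U>)); t \<in> carrier (\<O> (\<Union>\<U>));
        \<And>V. V \<in> \<U> \<Longrightarrow> res (\<Union>\<U>) V s = res (\<Union>\<U>) V t\<rbrakk> \<Longrightarrow> s = t"
    and gluing: "\<lbrakk>\<And>V. V \<in> \<U> \<Longrightarrow> openin X V;
        \<And>V. V \<in> \<U> \<Longrightarrow> f V \<in> carrier (\<O> V);
        \<And>V W. \<lbrakk>V \<in> \<U>; W \<in> \<U>\<rbrakk> \<Longrightarrow> res V (V \<inter> W) (f V) = res W (V \<inter> W) (f W)\<rbrakk>
      \<Longrightarrow> \<exists>s \<in> carrier (\<O> (\<Union>\<U>)). \<forall>V \<in> \<U>. res (\<Union>\<U>) V s = f V"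

section \<open>Stalks\<close>

text \<open>
  The stalk at \<open>x\<close> is the direct limit of the rings \<open>\<O> U\<close> over the open neighbourhoods \<open>U\<close> of
  \<open>x\<close>, realised as equivalence classes of pairs \<open>(U, s)\<close>. Each union in \<open>stalk\<close> below ranges over
  one and the same class, by \<open>stalk_mult_germ\<close> and \<open>stalk_add_germ\<close>.
\<close>

definition local_sections :: "'x topology \<Rightarrow> ('x set \<Rightarrow> 'a ring) \<Rightarrow> 'x \<Rightarrow> ('x set \<times> 'a) set" where
  "local_sections X \<O> x = {(U, s). openin X U \<and> x \<in> U \<and> s \<in> carrier (\<O> U)}"

definition germ_rel ::
    "'x topology \<Rightarrow> ('x set \<Rightarrow> 'a ring) \<Rightarrow> ('x set \<Rightarrow> 'x set \<Rightarrow> 'a \<Rightarrow> 'a) \<Rightarrow> 'x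
      \<Rightarrow> (('x set \<times> 'a) \<times> ('x set \<times> 'a)) set" where
  "germ_rel X \<O> res x = {((U, s), (V, t)).
     (U, s) \<in> local_sections X \<O> x \<and> (V, t) \<in> local_sections X \<O> x \<and>
     (\<exists>W. openin X W \<and> x \<in> W \<and> W \<subseteq> U \<inter> V \<and> res U W s = res V W t)}"

definition germ ::
    "'x topology \<Rightarrow> ('x set \<Rightarrow> 'a ring) \<Rightarrow> ('x set \<Rightarrow> 'x set \<Rightarrow> 'a \<Rightarrow> 'a) \<Rightarrow> 'x
      \<Rightarrow> 'x set \<Rightarrow> 'a \<Rightarrow> ('x set \<times> 'a) set" where
  "germ X \<O> res x U s = germ_rel X \<O> res x `` {(U, s)}"

definition stalk ::
    "'x topology \<Rightarrow> ('x set \<Rightarrow> 'a ring) \<Rightarrow> ('x set \<Rightarrow> 'x set \<Rightarrow> 'a \<Rightarrow> 'a) \<Rightarrow> 'x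
      \<Rightarrow> ('x set \<times> 'a) set ring" where
  "stalk X \<O> res x =
    \<lparr>carrier = local_sections X \<O> x // germ_rel X \<O> res x,
     mult = (\<lambda>A B. \<Union>(U, s) \<in> A. \<Union>(V, t) \<in> B.
       germ X \<O> res x (U \<inter> V) (res U (U \<inter> V) s \<otimes>\<^bsub>\<O> (U \<inter> V)\<^esub> res V (U \<inter> V) t)),
     one = germ X \<O> res x (topspace X) \<one>\<^bsub>\<O> (topspace X)\<^esub>,
     zero = germ X \<O> res x (topspace X) \<zero>\<^bsub>\<O> (topspace X)\<^esub>,
     add = (\<lambda>A B. \<Union>(U, s) \<in> A. \<Union>(V, t) \<in> B.
       germ X \<O> res x (U \<inter> V) (res U (U \<inter> V) s \<oplus>\<^bsub>\<O> (U \<inter> V)\<^esub> res V (U \<inter> V) t))\<rparr>"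

context ringed_space begin

lemma equiv_germ_rel: "equiv (local_sections X \<O> x) (germ_rel X \<O> res x)"
proof (rule equivI)
  show "germ_rel X \<O> res x \<subseteq> local_sections X \<O> x \<times> local_sections X \<O> x"
    by (auto simp: germ_rel_def)
  show "refl_on (local_sections X \<O> x) (germ_rel X \<O> res x)"
    by (rule refl_onI) (auto simp: germ_rel_def local_sections_def)
  show "sym (germ_rel X \<O> res x)"
  proof (rule symI, clarify)
    fix U s V t
    assume "((U, s), (V, t)) \<in> germ_rel X \<O> res x"
    then show "((V, t), (U, s)) \<in> germ_rel X \<O> res x"
      unfolding germ_rel_def by clarsimp (rule exI, auto)
  qed
  show "trans (germ_rel X \<O> res x)"
  proof (rule transI, clarify)
    fix U s V t W r
    assume 1: "((U, s), (V, t)) \<in> germ_rel X \<O> res x" and 2: "((V, t), (W, r)) \<in> germ_rel X \<O> res x"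
    from 1 obtain P where P: "openin X P" "x \<in> P" "P \<subseteq> U \<inter> V" "res U P s = res V P t"
      by (auto simp: germ_rel_def)
    from 2 obtain Q where Q: "openin X Q" "x \<in> Q" "Q \<subseteq> V \<inter> W" "res V Q t = res W Q r"
      by (auto simp: germ_rel_def)
    have m: "(U, s) \<in> local_sections X \<O> x" "(V, t) \<in> local_sections X \<O> x" "(W, r) \<in> local_sections X \<O> x"
      using 1 2 by (auto simp: germ_rel_def)
    have "res U (P \<inter> Q) s = res P (P \<inter> Q) (res U P s)"
      using m P Q by (subst res_res) (auto simp: local_sections_def)
    also have "\<dots> = res P (P \<inter> Q) (res V P t)" by (simp only: P)
    also have "\<dots> = res V (P \<inter> Q) t"
      using m P Q by (subst res_res) (auto simp: local_sections_def)
    also have "\<dots> = res Q (P \<inter> Q) (res V Q t)"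
      using m P Q by (subst res_res) (auto simp: local_sections_def)
    also have "\<dots> = res W (P \<inter> Q) r"
      using m P Q by (simp only: Q, subst res_res) (auto simp: local_sections_def)
    finally have "res U (P \<inter> Q) s = res W (P \<inter> Q) r" .
    then show "((U, s), (W, r)) \<in> germ_rel X \<O> res x"
      using m P Q unfolding germ_rel_def
      by (auto intro!: exI[of _ "P \<inter> Q"])
  qed
qed

lemma germ_op_cong:
  assumes op: "\<And>U V s t. \<lbrakk>openin X U; openin X V; V \<subseteq> U; s \<in> carrier (\<O> U); t \<in> carrier (\<O> U)\<rbrakk>
      \<Longrightarrow> res U V (f U s t) = f V (res U V s) (res U V t)"
    and cl: "\<And>U s t. \<lbrakk>openin X U; s \<in> carrier (\<O> U); t \<in> carrier (\<O> U)\<rbrakk> \<Longrightarrow> f U s t \<in> carrier (\<O> U)"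
    and U: "((U, s), (U', s')) \<in> germ_rel X \<O> res x"
    and V: "((V, t), (V', t')) \<in> germ_rel X \<O> res x"
  shows "germ X \<O> res x (U \<inter> V) (f (U \<inter> V) (res U (U \<inter> V) s) (res V (U \<inter> V) t))
    = germ X \<O> res x (U' \<inter> V') (f (U' \<inter> V') (res U' (U' \<inter> V') s') (res V' (U' \<inter> V') t'))"
proof -
  from U obtain P where P: "openin X P" "x \<in> P" "P \<subseteq> U \<inter> U'" "res U P s = res U' P s'"
    by (auto simp: germ_rel_def)
  from V obtain Q where Q: "openin X Q" "x \<in> Q" "Q \<subseteq> V \<inter> V'" "res V Q t = res V' Q t'"
    by (auto simp: germ_rel_def)
  have m: "openin X U" "openin X U'" "openin X V" "openin X V'" "x \<in> U" "x \<in> U'" "x \<in> V" "x \<in> V'"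
     "s \<in> carrier (\<O> U)" "s' \<in> carrier (\<O> U')" "t \<in> carrier (\<O> V)" "t' \<in> carrier (\<O> V')"
    using U V by (auto simp: germ_rel_def local_sections_def)
  note rc = ring_hom_closed[OF res_hom]
  have *: "res (A \<inter> B) (P \<inter> Q) (f (A \<inter> B) (res A (A \<inter> B) a) (res B (A \<inter> B) b)) 
      = f (P \<inter> Q) (res P (P \<inter> Q) (res A P a)) (res Q (P \<inter> Q) (res B Q b))"
    if "openin X A" "openin X B" "P \<subseteq> A" "Q \<subseteq> B" "a \<in> carrier (\<O> A)" "b \<in> carrier (\<O> B)" for A B a b
  proof -
    have "openin X (A \<inter> B)" "openin X (P \<inter> Q)" "P \<inter> Q \<subseteq> A \<inter> B" using that P Q by auto
    then show ?thesis using that P Q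
      by (subst op) (auto intro!: rc simp: res_res)
  qed
  have eq: "res (U \<inter> V) (P \<inter> Q) (f (U \<inter> V) (res U (U \<inter> V) s) (res V (U \<inter> V) t))
      = res (U' \<inter> V') (P \<inter> Q) (f (U' \<inter> V') (res U' (U' \<inter> V') s') (res V' (U' \<inter> V') t'))"
    using m P Q by (subst (1 2) *) auto
  have c: "f (A \<inter> B) (res A (A \<inter> B) a) (res B (A \<inter> B) b) \<in> carrier (\<O> (A \<inter> B))"
    if "openin X A" "openin X B" "a \<in> carrier (\<O> A)" "b \<in> carrier (\<O> B)" for A B a b
    using that by (intro cl rc[of A "A \<inter> B"] rc[of B "A \<inter> B"]) auto
  show ?thesis
    unfolding germ_def
    apply (rule equiv_class_eq[OF equiv_germ_rel])
    using m P Q eq c[of U V s t] c[of U' V' s' t']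
    by (auto simp: germ_rel_def local_sections_def intro!: exI[of _ "P \<inter> Q"])
qed

lemma germ_op_UN:
  assumes op: "\<And>U V s t. \<lbrakk>openin X U; openin X V; V \<subseteq> U; s \<in> carrier (\<O> U); t \<in> carrier (\<O> U)\<rbrakk>
      \<Longrightarrow> res U V (f U s t) = f V (res U V s) (res U V t)"
    and cl: "\<And>U s t. \<lbrakk>openin X U; s \<in> carrier (\<O> U); t \<in> carrier (\<O> U)\<rbrakk> \<Longrightarrow> f U s t \<in> carrier (\<O> U)"
    and U: "(U, s) \<in> local_sections X \<O> x" and V: "(V, t) \<in> local_sections X \<O> x"
  shows "(\<Union>(U', s') \<in> germ X \<O> res x U s. \<Union>(V', t') \<in> germ X \<O> res x V t.
       germ X \<O> res x (U' \<inter> V') (f (U' \<inter> V') (res U' (U' \<inter> V') s') (res V' (U' \<inter> V') t')))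
    = germ X \<O> res x (U \<inter> V) (f (U \<inter> V) (res U (U \<inter> V) s) (res V (U \<inter> V) t))" (is "?L = ?R")
proof -
  have self: "(U, s) \<in> germ X \<O> res x U s" "(V, t) \<in> germ X \<O> res x V t"
    using U V equiv_class_self[OF equiv_germ_rel] by (auto simp: germ_def)
  have "germ X \<O> res x (U' \<inter> V') (f (U' \<inter> V') (res U' (U' \<inter> V') s') (res V' (U' \<inter> V') t')) = ?R"
    if "(U', s') \<in> germ X \<O> res x U s" "(V', t') \<in> germ X \<O> res x V t" for U' s' V' t'
    using that germ_op_cong[of f, OF op cl, of U s U' s' x V t V' t'] by (simp add: germ_def)
  then show ?thesis using self by fast
qed

lemma stalk_mult_germ:
  assumes "(U, s) \<in> local_sections X \<O> x" "(V, t) \<in> local_sections X \<O> x"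
  shows "germ X \<O> res x U s \<otimes>\<^bsub>stalk X \<O> res x\<^esub> germ X \<O> res x V t
    = germ X \<O> res x (U \<inter> V) (res U (U \<inter> V) s \<otimes>\<^bsub>\<O> (U \<inter> V)\<^esub> res V (U \<inter> V) t)"
  unfolding stalk_def using assms
  by (simp, intro germ_op_UN)
    (auto intro: ring_hom_mult[OF res_hom] monoid.m_closed ring.is_monoid cring.axioms(1)[OF cring_sections])

lemma stalk_add_germ:
  assumes "(U, s) \<in> local_sections X \<O> x" "(V, t) \<in> local_sections X \<O> x"
  shows "germ X \<O> res x U s \<oplus>\<^bsub>stalk X \<O> res x\<^esub> germ X \<O> res x V t
    = germ X \<O> res x (U \<inter> V) (res U (U \<inter> V) s \<oplus>\<^bsub>\<O> (U \<inter> V)\<^esub> res V (U \<inter> V) t)"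
  unfolding stalk_def using assms
  by (simp, intro germ_op_UN)
    (auto intro: ring_hom_add[OF res_hom] ring.ring_simprules(1) cring.axioms(1)[OF cring_sections])

end

section \<open>Locally ringed spaces\<close>

definition local_ring :: "'a ring \<Rightarrow> bool" where
  "local_ring R \<longleftrightarrow> cring R \<and> (\<exists>!M. maximalideal M R)"

definition the_maximal_ideal :: "'a ring \<Rightarrow> 'a set" where
  "the_maximal_ideal R = (THE M. maximalideal M R)"

locale locally_ringed_space = ringed_space +
  assumes local_stalk: "x \<in> topspace X \<Longrightarrow> local_ring (stalk X \<O> res x)"

definition nonvanishing_set ::
    "'x topology \<Rightarrow> ('x set \<Rightarrow> 'a ring) \<Rightarrow> ('x set \<Rightarrow> 'x set \<Rightarrow> 'a \<Rightarrow> 'a) \<Rightarrow> 'a \<Rightarrow> 'x set" where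
  "nonvanishing_set X \<O> res s =
    {x \<in> topspace X. germ X \<O> res x (topspace X) s \<notin> the_maximal_ideal (stalk X \<O> res x)}"

end

theory Submission
  imports Defs "HOL-Algebra.Ring_Divisibility"
begin

text \<open>
  In a local ring the only idempotents are 0 and 1, so the germ of an idempotent section \<open>e\<close> is
  0 or 1 at every point, and \<open>X\<^sub>e\<close> is the set where it is 1. Equality of germs being an open
  condition, \<open>X\<^sub>e\<close> and its complement are both open; computing with 0 and 1 in the stalks gives
  the homomorphism property. As \<open>X\<^sub>e\<close> determines all germs of \<open>e\<close>, it determines \<open>e\<close>.
  Conversely, the section glued from 1 on a clopen set \<open>A\<close> and 0 on its complement is an
  idempotent \<open>e\<close> with \<open>X\<^sub>e = A\<close>.
\<close>

section \<open>Idempotents in local rings\<close>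

text \<open>Zorn's lemma on the ideals above \<open>I\<close> that avoid \<open>\<one>\<close>.
  Stating properness as \<open>\<one> \<notin> J\<close> makes it pass to unions of chains.\<close>

lemma (in ring) proper_ideal_imp_maximalideal:
  assumes "ideal I R" "\<one> \<notin> I"
  shows "\<exists>M. maximalideal M R \<and> I \<subseteq> M"
proof -
  define S where "S = {J. ideal J R \<and> \<one> \<notin> J \<and> I \<subseteq> J}"
  have "\<Union>C \<in> S" if C: "C \<noteq> {}" "subset.chain S C" for C
  proof -
    have "subset.chain {J. ideal J R} C"
      using C(2) by (auto simp: S_def pred_on.chain_def)
    then have "ideal (\<Union>C) R"
      using chain_Union_is_ideal[of C] C(1) by simp
    then show ?thesis
      using C by (auto simp: S_def pred_on.chain_def)
  qed
  moreover have "S \<noteq> {}" using assms by (auto simp: S_def)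
  ultimately obtain M where M: "M \<in> S" "\<And>J. J \<in> S \<Longrightarrow> M \<subseteq> J \<Longrightarrow> J = M"
    using subset_Zorn_nonempty[of S] by metis
  have "maximalideal M R"
  proof (rule maximalidealI)
    show "ideal M R" "carrier R \<noteq> M" using M(1) by (auto simp: S_def)
    show "J = M \<or> J = carrier R" if "ideal J R" "M \<subseteq> J" for J
      using M that ideal.one_imp_carrier[of J R] by (auto simp: S_def)
  qed
  then show ?thesis using M(1) by (auto simp: S_def)
qed

lemma maximalideal_the_maximal_ideal:
  assumes "local_ring R"
  shows "maximalideal (the_maximal_ideal R) R"
  using assms theI'[of "\<lambda>M. maximalideal M R"]
  by (simp add: local_ring_def the_maximal_ideal_def)

lemma local_ring_one_notin_maximal:
  assumes "local_ring R"
  shows "\<one>\<^bsub>R\<^esub> \<notin> the_maximal_ideal R"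
proof -
  interpret maximalideal "the_maximal_ideal R" R
    using assms by (rule maximalideal_the_maximal_ideal)
  show ?thesis using I_notcarr one_imp_carrier by blast
qed

lemma local_ring_zero_in_maximal:
  assumes "local_ring R"
  shows "\<zero>\<^bsub>R\<^esub> \<in> the_maximal_ideal R"
proof -
  interpret maximalideal "the_maximal_ideal R" R
    using assms by (rule maximalideal_the_maximal_ideal)
  show ?thesis by simp
qed

text \<open>A non-unit generates a proper ideal, which lies in some maximal ideal; uniqueness makes
  that ideal \<open>the_maximal_ideal R\<close>.\<close>

lemma local_ring_Units:
  assumes R: "local_ring R" and a: "a \<in> carrier R" "a \<notin> the_maximal_ideal R"
  shows "a \<in> Units R"
proof (rule ccontr)
  interpret cring R using R by (simp add: local_ring_def)
  assume "a \<notin> Units R"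
  then have "\<one>\<^bsub>R\<^esub> \<notin> PIdl\<^bsub>R\<^esub> a"
    using ideal_eq_carrier_iff[OF a(1)] ideal.one_imp_carrier[OF cgenideal_ideal[OF a(1)]] by auto
  then obtain M where M: "maximalideal M R" "PIdl\<^bsub>R\<^esub> a \<subseteq> M"
    using proper_ideal_imp_maximalideal[OF cgenideal_ideal[OF a(1)]] by auto
  then have "M = the_maximal_ideal R"
    using R maximalideal_the_maximal_ideal[OF R] by (auto simp: local_ring_def)
  then show False using M(2) a(2) cgenideal_self[OF a(1)] by auto
qed

text \<open>Since \<open>e\<close> and \<open>f = 1 - e\<close> sum to 1, they cannot both lie in
  the maximal ideal. One of them is then a unit, and \<open>e f = 0\<close> forces the other to
  vanish.\<close>

lemma local_ring_idempotent:
  assumes R: "local_ring R" and e: "e \<in> carrier R" "e \<otimes>\<^bsub>R\<^esub> e = e"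
  shows "e = \<zero>\<^bsub>R\<^esub> \<or> e = \<one>\<^bsub>R\<^esub>"
proof -
  interpret cring R using R by (simp add: local_ring_def)
  interpret M: maximalideal "the_maximal_ideal R" R
    using R by (rule maximalideal_the_maximal_ideal)
  define f where "f = \<one>\<^bsub>R\<^esub> \<ominus>\<^bsub>R\<^esub> e"
  have f: "f \<in> carrier R" "e \<oplus>\<^bsub>R\<^esub> f = \<one>\<^bsub>R\<^esub>"
    using e(1) a_comm[of e "\<one>\<^bsub>R\<^esub> \<ominus>\<^bsub>R\<^esub> e"] by (simp_all add: f_def a_minus_def a_assoc l_neg)
  have ef: "e \<otimes>\<^bsub>R\<^esub> f = \<zero>\<^bsub>R\<^esub>"
    using e by (simp add: f_def a_minus_def r_distr r_minus r_neg)
  have "\<not> (e \<in> the_maximal_ideal R \<and> f \<in> the_maximal_ideal R)"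
    using M.a_closed f(2) local_ring_one_notin_maximal[OF R] by metis
  then consider "e \<in> Units R" | "f \<in> Units R"
    using local_ring_Units[OF R] e(1) f(1) by blast
  then show ?thesis
  proof cases
    \<comment> \<open>Cancel the unit \<open>e\<close> in \<open>e f = 0 = e 0\<close>; the other
      case cancels \<open>f\<close>.\<close>
    case 1
    then have "f = \<zero>\<^bsub>R\<^esub>"
      using ef e(1) f(1) Units_l_cancel[of e f "\<zero>\<^bsub>R\<^esub>"] by simp
    then show ?thesis using f(2) e(1) by simp
  next
    case 2
    then have "e = \<zero>\<^bsub>R\<^esub>"
      using ef e(1) f(1) m_comm[of e f] Units_l_cancel[of f e "\<zero>\<^bsub>R\<^esub>"] by simp
    then show ?thesis by simp
  qed
qed

section \<open>Germs of global sections\<close>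

context ringed_space begin

lemma res_closed:
  "\<lbrakk>openin X U; openin X V; V \<subseteq> U; s \<in> carrier (\<O> U)\<rbrakk> \<Longrightarrow> res U V s \<in> carrier (\<O> V)"
  using ring_hom_closed[OF res_hom] .

text \<open>The empty family covers the empty set, so locality has nothing to check.\<close>

lemma sections_empty:
  assumes "s \<in> carrier (\<O> {})" "t \<in> carrier (\<O> {})"
  shows "s = t"
  by (rule locality[of "{}"]) (use assms in auto)

text \<open>For global sections the inclusion of \<open>W\<close> demanded by
  \<open>germ_rel\<close> is automatic, as open sets lie in \<open>topspace X\<close>.\<close>

lemma germ_eq_iff:
  assumes "x \<in> topspace X" "s \<in> carrier (\<O> (topspace X))" "t \<in> carrier (\<O> (topspace X))"
  shows "germ X \<O> res x (topspace X) s = germ X \<O> res x (topspace X) t \<longleftrightarrow>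
    (\<exists>W. openin X W \<and> x \<in> W \<and> res (topspace X) W s = res (topspace X) W t)"
proof -
  have "(topspace X, s) \<in> local_sections X \<O> x" "(topspace X, t) \<in> local_sections X \<O> x"
    using assms by (auto simp: local_sections_def)
  then have "germ X \<O> res x (topspace X) s = germ X \<O> res x (topspace X) t \<longleftrightarrow>
      ((topspace X, s), (topspace X, t)) \<in> germ_rel X \<O> res x"
    unfolding germ_def using eq_equiv_class_iff[OF equiv_germ_rel] by auto
  then show ?thesis
    using assms by (auto simp: germ_rel_def local_sections_def dest: openin_subset)
qed

text \<open>A neighbourhood witnessing equality of germs at \<open>x\<close> witnesses it at each of
  its own points.\<close>

lemma openin_germ_eq:
  assumes "s \<in> carrier (\<O> (topspace X))" "t \<in> carrier (\<O> (topspace X))"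
  shows "openin X
    {x \<in> topspace X. germ X \<O> res x (topspace X) s = germ X \<O> res x (topspace X) t}"
proof (subst openin_subopen, clarify)
  fix x
  assume x: "x \<in> topspace X" "germ X \<O> res x (topspace X) s = germ X \<O> res x (topspace X) t"
  then obtain W where W: "openin X W" "x \<in> W" "res (topspace X) W s = res (topspace X) W t"
    using germ_eq_iff[OF x(1) assms] by auto
  then have "germ X \<O> res y (topspace X) s = germ X \<O> res y (topspace X) t" if "y \<in> W" for y
    using that germ_eq_iff[OF _ assms] openin_subset by blast
  then show "\<exists>T. openin X T \<and> x \<in> T \<and> T \<subseteq>
      {x \<in> topspace X. germ X \<O> res x (topspace X) s = germ X \<O> res x (topspace X) t}"
    using W openin_subset by blast
qed

lemma section_eq_if_germs_eq:
  assumes "s \<in> carrier (\<O> (topspace X))" "t \<in> carrier (\<O> (topspace X))"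
    and "\<And>x. x \<in> topspace X
      \<Longrightarrow> germ X \<O> res x (topspace X) s = germ X \<O> res x (topspace X) t"
  shows "s = t"
proof -
  \<comment> \<open>Taking all open sets on which \<open>s\<close> and \<open>t\<close> agree avoids
    choosing a neighbourhood for each point; equality of germs says that they cover the
    space.\<close>
  define \<U> where "\<U> = {W. openin X W \<and> res (topspace X) W s = res (topspace X) W t}"
  have "\<exists>W \<in> \<U>. x \<in> W" if "x \<in> topspace X" for x
    using germ_eq_iff[OF that assms(1,2)] assms(3)[OF that] by (auto simp: \<U>_def)
  then have U: "\<Union>\<U> = topspace X"
    by (auto simp: \<U>_def dest: openin_subset)
  show ?thesis
    by (rule locality[of \<U>]) (use assms in \<open>auto simp: U\<close>, auto simp: \<U>_def)
qed

text \<open>The stalk operations restrict to an intersection of domains; for two global sections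
  this is \<open>topspace X\<close> again and restriction is the identity.\<close>

lemma germ_ring_hom:
  assumes "x \<in> topspace X"
  shows "germ X \<O> res x (topspace X) \<in> ring_hom (\<O> (topspace X)) (stalk X \<O> res x)"
proof (rule ring_hom_memI)
  have loc: "(topspace X, s) \<in> local_sections X \<O> x" if "s \<in> carrier (\<O> (topspace X))" for s
    using that assms by (auto simp: local_sections_def)
  show "germ X \<O> res x (topspace X) s \<in> carrier (stalk X \<O> res x)"
    if "s \<in> carrier (\<O> (topspace X))" for s
    using loc[OF that] by (auto simp: stalk_def germ_def intro: quotientI)
  show "germ X \<O> res x (topspace X) (s \<otimes>\<^bsub>\<O> (topspace X)\<^esub> t)
      = germ X \<O> res x (topspace X) s \<otimes>\<^bsub>stalk X \<O> res x\<^esub> germ X \<O> res x (topspace X) t"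
    and "germ X \<O> res x (topspace X) (s \<oplus>\<^bsub>\<O> (topspace X)\<^esub> t)
      = germ X \<O> res x (topspace X) s \<oplus>\<^bsub>stalk X \<O> res x\<^esub> germ X \<O> res x (topspace X) t"
    if "s \<in> carrier (\<O> (topspace X))" "t \<in> carrier (\<O> (topspace X))" for s t
    using that loc by (simp_all add: stalk_mult_germ stalk_add_germ res_id)
  show "germ X \<O> res x (topspace X) \<one>\<^bsub>\<O> (topspace X)\<^esub> = \<one>\<^bsub>stalk X \<O> res x\<^esub>"
    by (simp add: stalk_def)
qed

text \<open>\<open>ring_hom\<close> imposes no condition at zero, and deriving one would require the
  stalk to be a ring; here the definition of \<open>stalk\<close> suffices.\<close>

lemma germ_zero: "germ X \<O> res x (topspace X) \<zero>\<^bsub>\<O> (topspace X)\<^esub> = \<zero>\<^bsub>stalk X \<O> res x\<^esub>"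
  by (simp add: stalk_def)

end

section \<open>Idempotent sections and clopen sets\<close>

lemma carrier_idempotent_ring_iff:
  "e \<in> carrier (idempotent_ring R) \<longleftrightarrow> e \<in> carrier R \<and> e \<otimes>\<^bsub>R\<^esub> e = e"
  by (simp add: idempotent_ring_def eq_commute[of e])

text \<open>Writing the multiple by 2 as a sum lets a homomorphism be pushed through the
  formula.\<close>

lemma add_idempotent_ring:
  assumes "cring R" "e \<in> carrier R" "f \<in> carrier R"
  shows "e \<oplus>\<^bsub>idempotent_ring R\<^esub> f
    = (e \<oplus>\<^bsub>R\<^esub> f) \<ominus>\<^bsub>R\<^esub> (e \<otimes>\<^bsub>R\<^esub> f \<oplus>\<^bsub>R\<^esub> e \<otimes>\<^bsub>R\<^esub> f)"
proof -
  interpret cring R by fact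
  show ?thesis
    using assms by (simp add: idempotent_ring_def numeral_2_eq_2 add.nat_pow_Suc)
qed

context locally_ringed_space begin

section \<open>Zero-one values of idempotent germs\<close>

lemma stalk_cring: "x \<in> topspace X \<Longrightarrow> cring (stalk X \<O> res x)"
  using local_stalk by (simp add: local_ring_def)

lemma stalk_zero_neq_one: "x \<in> topspace X \<Longrightarrow> \<zero>\<^bsub>stalk X \<O> res x\<^esub> \<noteq> \<one>\<^bsub>stalk X \<O> res x\<^esub>"
  using local_ring_one_notin_maximal[OF local_stalk] local_ring_zero_in_maximal[OF local_stalk]
  by metis

text \<open>The germ is an idempotent of a local ring, hence 0 or 1; only 0 lies in the maximal
  ideal. Later identities thus become pointwise computations with 0 and 1.\<close>

lemma germ_idempotent:
  assumes "e \<in> carrier (idempotent_ring (\<O> (topspace X)))" and x: "x \<in> topspace X"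
  shows "germ X \<O> res x (topspace X) e =
    (if x \<in> nonvanishing_set X \<O> res e then \<one>\<^bsub>stalk X \<O> res x\<^esub> else \<zero>\<^bsub>stalk X \<O> res x\<^esub>)"
proof -
  have e: "e \<in> carrier (\<O> (topspace X))" "e \<otimes>\<^bsub>\<O> (topspace X)\<^esub> e = e"
    using assms(1) by (auto simp: carrier_idempotent_ring_iff)
  note h = ring_hom_memE[OF germ_ring_hom[OF x]]
  have "germ X \<O> res x (topspace X) e = \<zero>\<^bsub>stalk X \<O> res x\<^esub>
      \<or> germ X \<O> res x (topspace X) e = \<one>\<^bsub>stalk X \<O> res x\<^esub>"
    by (rule local_ring_idempotent[OF local_stalk[OF x] h(1)[OF e(1)]
          h(2)[OF e(1) e(1), unfolded e(2), symmetric]])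
  moreover have "x \<in> nonvanishing_set X \<O> res e
      \<longleftrightarrow> germ X \<O> res x (topspace X) e \<notin> the_maximal_ideal (stalk X \<O> res x)"
    using x by (simp add: nonvanishing_set_def)
  ultimately show ?thesis
    using local_ring_one_notin_maximal[OF local_stalk[OF x]]
      local_ring_zero_in_maximal[OF local_stalk[OF x]]
    by metis
qed

lemma nonvanishing_idempotent_iff:
  assumes "e \<in> carrier (idempotent_ring (\<O> (topspace X)))" "x \<in> topspace X"
  shows "x \<in> nonvanishing_set X \<O> res e
    \<longleftrightarrow> germ X \<O> res x (topspace X) e = \<one>\<^bsub>stalk X \<O> res x\<^esub>"
  using germ_idempotent[OF assms] stalk_zero_neq_one[OF assms(2)] by auto

lemma nonvanishing_subset: "nonvanishing_set X \<O> res e \<subseteq> topspace X"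
  by (auto simp: nonvanishing_set_def)

lemma nonvanishing_idempotent_clopen:
  assumes e: "e \<in> carrier (idempotent_ring (\<O> (topspace X)))"
  shows "nonvanishing_set X \<O> res e \<in> carrier (clopen_ring X)"
proof -
  interpret cring "\<O> (topspace X)" by (rule cring_sections) simp
  have e': "e \<in> carrier (\<O> (topspace X))" using e by (simp add: carrier_idempotent_ring_iff)
  \<comment> \<open>Both the set and its complement are loci where the germ of \<open>e\<close>
    equals that of a fixed global section, 1 or 0.\<close>
  have "nonvanishing_set X \<O> res e = {x \<in> topspace X.
      germ X \<O> res x (topspace X) e = germ X \<O> res x (topspace X) \<one>\<^bsub>\<O> (topspace X)\<^esub>}"
    using nonvanishing_idempotent_iff[OF e] nonvanishing_subset ring_hom_one[OF germ_ring_hom]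
    by (auto; metis subsetD)
  moreover have "topspace X - nonvanishing_set X \<O> res e = {x \<in> topspace X.
      germ X \<O> res x (topspace X) e = germ X \<O> res x (topspace X) \<zero>\<^bsub>\<O> (topspace X)\<^esub>}"
    using germ_idempotent[OF e] stalk_zero_neq_one[symmetric] by (auto simp: germ_zero split: if_splits)
  ultimately show ?thesis
    using openin_germ_eq[OF e'] nonvanishing_subset by (simp add: clopen_ring_def closedin_def)
qed

section \<open>Products and sums of idempotents\<close>

lemma nonvanishing_mult:
  assumes e: "e \<in> carrier (idempotent_ring (\<O> (topspace X)))"
    and f: "f \<in> carrier (idempotent_ring (\<O> (topspace X)))"
  shows "nonvanishing_set X \<O> res (e \<otimes>\<^bsub>idempotent_ring (\<O> (topspace X))\<^esub> f)
    = nonvanishing_set X \<O> res e \<inter> nonvanishing_set X \<O> res f"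
proof -
  \<comment> \<open>Closure under the product is needed to apply
    \<open>nonvanishing_idempotent_iff\<close> to it.\<close>
  interpret B: boolean_ring "idempotent_ring (\<O> (topspace X))"
    by (intro boolean_ring_idempotent_ring cring_sections) simp
  have "x \<in> nonvanishing_set X \<O> res (e \<otimes>\<^bsub>idempotent_ring (\<O> (topspace X))\<^esub> f)
      \<longleftrightarrow> x \<in> nonvanishing_set X \<O> res e \<inter> nonvanishing_set X \<O> res f"
    if x: "x \<in> topspace X" for x
  proof -
    interpret cring "stalk X \<O> res x" using x by (rule stalk_cring)
    have "germ X \<O> res x (topspace X) (e \<otimes>\<^bsub>idempotent_ring (\<O> (topspace X))\<^esub> f)
        = germ X \<O> res x (topspace X) e \<otimes>\<^bsub>stalk X \<O> res x\<^esub> germ X \<O> res x (topspace X) f"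
      using ring_hom_mult[OF germ_ring_hom[OF x]] e f by (simp add: idempotent_ring_def)
    then show ?thesis
      unfolding nonvanishing_idempotent_iff[OF B.m_closed[OF e f] x]
        germ_idempotent[OF e x] germ_idempotent[OF f x]
      using stalk_zero_neq_one[OF x] by auto
  qed
  then show ?thesis using nonvanishing_subset by blast
qed

text \<open>On the values 0 and 1 the expression \<open>a + b - 2ab\<close> is exclusive or, in any
  characteristic.\<close>

lemma nonvanishing_add:
  assumes e: "e \<in> carrier (idempotent_ring (\<O> (topspace X)))"
    and f: "f \<in> carrier (idempotent_ring (\<O> (topspace X)))"
  shows "nonvanishing_set X \<O> res (e \<oplus>\<^bsub>idempotent_ring (\<O> (topspace X))\<^esub> f)
    = (nonvanishing_set X \<O> res e \<union> nonvanishing_set X \<O> res f)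
      - (nonvanishing_set X \<O> res e \<inter> nonvanishing_set X \<O> res f)"
proof -
  interpret R: cring "\<O> (topspace X)" by (rule cring_sections) simp
  interpret B: boolean_ring "idempotent_ring (\<O> (topspace X))"
    by (intro boolean_ring_idempotent_ring R.is_cring)
  have c: "e \<in> carrier (\<O> (topspace X))" "f \<in> carrier (\<O> (topspace X))"
    using e f by (auto simp: carrier_idempotent_ring_iff)
  have "x \<in> nonvanishing_set X \<O> res (e \<oplus>\<^bsub>idempotent_ring (\<O> (topspace X))\<^esub> f)
      \<longleftrightarrow> x \<in> (nonvanishing_set X \<O> res e \<union> nonvanishing_set X \<O> res f)
        - (nonvanishing_set X \<O> res e \<inter> nonvanishing_set X \<O> res f)"
    if x: "x \<in> topspace X" for x
  proof -
    interpret S: cring "stalk X \<O> res x" using x by (rule stalk_cring)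
    \<comment> \<open>In this form the germ map also commutes with the negation in the formula for
      the sum.\<close>
    interpret h: ring_hom_cring "\<O> (topspace X)" "stalk X \<O> res x" "germ X \<O> res x (topspace X)"
      using germ_ring_hom[OF x]
      by (intro ring_hom_cringI ring_hom_ringI2)
        (rule R.ring_axioms S.ring_axioms R.is_cring S.is_cring | assumption)+
    have "germ X \<O> res x (topspace X) (e \<oplus>\<^bsub>idempotent_ring (\<O> (topspace X))\<^esub> f)
        = (germ X \<O> res x (topspace X) e \<oplus>\<^bsub>stalk X \<O> res x\<^esub> germ X \<O> res x (topspace X) f)
        \<ominus>\<^bsub>stalk X \<O> res x\<^esub>
          (germ X \<O> res x (topspace X) e \<otimes>\<^bsub>stalk X \<O> res x\<^esub> germ X \<O> res x (topspace X) f
          \<oplus>\<^bsub>stalk X \<O> res x\<^esub>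
          germ X \<O> res x (topspace X) e \<otimes>\<^bsub>stalk X \<O> res x\<^esub> germ X \<O> res x (topspace X) f)"
      using c by (simp add: add_idempotent_ring[OF R.is_cring c] a_minus_def)
    then show ?thesis
      unfolding nonvanishing_idempotent_iff[OF B.a_closed[OF e f] x]
        germ_idempotent[OF e x] germ_idempotent[OF f x]
      using stalk_zero_neq_one[OF x] by (auto simp: a_minus_def S.r_neg)
  qed
  then show ?thesis using nonvanishing_subset by blast
qed

lemma nonvanishing_one: "nonvanishing_set X \<O> res \<one>\<^bsub>\<O> (topspace X)\<^esub> = topspace X"
  using local_ring_one_notin_maximal[OF local_stalk] ring_hom_one[OF germ_ring_hom]
  by (auto simp: nonvanishing_set_def)

section \<open>Injectivity and surjectivity\<close>

lemma nonvanishing_inj: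
  "inj_on (\<lambda>s. nonvanishing_set X \<O> res s) (carrier (idempotent_ring (\<O> (topspace X))))"
proof (rule inj_onI)
  fix e f
  assume ef: "e \<in> carrier (idempotent_ring (\<O> (topspace X)))"
      "f \<in> carrier (idempotent_ring (\<O> (topspace X)))"
    and eq: "nonvanishing_set X \<O> res e = nonvanishing_set X \<O> res f"
  show "e = f"
    \<comment> \<open>By \<open>germ_idempotent\<close> the common nonvanishing set fixes both germs
      at every point.\<close>
    by (rule section_eq_if_germs_eq)
      (use ef eq in \<open>simp_all add: germ_idempotent\<close>, simp_all add: carrier_idempotent_ring_iff)
qed

lemma nonvanishing_surj:
  assumes "A \<in> carrier (clopen_ring X)"
  shows "\<exists>e \<in> carrier (idempotent_ring (\<O> (topspace X))). nonvanishing_set X \<O> res e = A"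
proof -
  let ?T = "topspace X"
  define B where "B = ?T - A"
  have A: "openin X A" "openin X B" "A \<subseteq> ?T" "B \<subseteq> ?T" "A \<union> B = ?T" "A \<inter> B = {}"
    using assms openin_subset by (auto simp: B_def clopen_ring_def closedin_def)
  interpret T: cring "\<O> ?T" by (rule cring_sections) simp
  interpret RA: cring "\<O> A" using A(1) by (rule cring_sections)
  interpret RB: cring "\<O> B" using A(2) by (rule cring_sections)
  define f where "f V = (if V = A then \<one>\<^bsub>\<O> V\<^esub> else \<zero>\<^bsub>\<O> V\<^esub>)" for V
  have f: "f V \<in> carrier (\<O> V)" if "V \<in> {A, B}" for V
    using that by (auto simp: f_def)
  have "res V (V \<inter> W) (f V) = res W (V \<inter> W) (f W)" if "V \<in> {A, B}" "W \<in> {A, B}" for V W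
  \<comment> \<open>Distinct members of the cover are disjoint, and over the empty set all sections
    coincide.\<close>
  proof (cases "V = W")
    case False
    then have "V \<inter> W = {}" using that A(6) by auto
    moreover have "openin X V" "openin X W" using that A by auto
    ultimately show ?thesis
      using f that by (intro sections_empty) (auto intro: res_closed)
  qed simp
  then obtain e where "e \<in> carrier (\<O> (\<Union>{A, B}))" "\<forall>V\<in>{A, B}. res (\<Union>{A, B}) V e = f V"
    using gluing[of "{A, B}" f] f A by blast
  then have e: "e \<in> carrier (\<O> ?T)" "res ?T A e = f A" "res ?T B e = f B"
    using A(5) by auto
  have hA: "res ?T A \<in> ring_hom (\<O> ?T) (\<O> A)" and hB: "res ?T B \<in> ring_hom (\<O> ?T) (\<O> B)"
    using A by (auto intro: res_hom)
  have resA: "res ?T A e = \<one>\<^bsub>\<O> A\<^esub>" using e by (simp add: f_def)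
  \<comment> \<open>If \<open>B = A\<close>, both are empty and \<open>f B\<close> is 1, which is also 0.\<close>
  have resB: "res ?T B e = \<zero>\<^bsub>\<O> B\<^esub>"
    using e A(6) sections_empty[of "\<one>\<^bsub>\<O> B\<^esub>" "\<zero>\<^bsub>\<O> B\<^esub>"] RB.one_closed RB.zero_closed
    by (cases "B = A") (auto simp: f_def)
  \<comment> \<open>Idempotency is local: it holds for 1 over \<open>A\<close> and for 0 over
    \<open>B\<close>.\<close>
  have ee: "e \<otimes>\<^bsub>\<O> ?T\<^esub> e = e"
  proof (rule locality[of "{A, B}"])
    show "res (\<Union>{A, B}) V (e \<otimes>\<^bsub>\<O> ?T\<^esub> e) = res (\<Union>{A, B}) V e" if "V \<in> {A, B}" for V
      using that ring_hom_mult[OF hA e(1) e(1)] ring_hom_mult[OF hB e(1) e(1)] A(5) resA resB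
      by auto
  qed (use A e in auto)
  then have eB: "e \<in> carrier (idempotent_ring (\<O> ?T))"
    using e by (simp add: carrier_idempotent_ring_iff)
  \<comment> \<open>\<open>A\<close> itself is a neighbourhood of \<open>x\<close> on which
    \<open>e\<close> agrees with 1; likewise \<open>B\<close> and 0 below.\<close>
  have 1: "germ X \<O> res x ?T e = \<one>\<^bsub>stalk X \<O> res x\<^esub>" if "x \<in> A" for x
  proof -
    have "x \<in> ?T" using that A by auto
    moreover have "germ X \<O> res x ?T e = germ X \<O> res x ?T \<one>\<^bsub>\<O> ?T\<^esub>"
      using germ_eq_iff[OF \<open>x \<in> ?T\<close> e(1) T.one_closed] that A(1) resA ring_hom_one[OF hA] by auto
    ultimately show ?thesis using ring_hom_one[OF germ_ring_hom] by simp
  qed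
  have 0: "germ X \<O> res x ?T e = \<zero>\<^bsub>stalk X \<O> res x\<^esub>" if "x \<in> B" for x
  proof -
    have "x \<in> ?T" using that A by auto
    moreover have "res ?T B \<zero>\<^bsub>\<O> ?T\<^esub> = \<zero>\<^bsub>\<O> B\<^esub>"
      using ring_hom_zero[OF hB T.ring_axioms RB.ring_axioms] .
    ultimately show ?thesis
      using germ_eq_iff[OF \<open>x \<in> ?T\<close> e(1) T.zero_closed] that A(2) resB germ_zero by auto
  qed
  have "x \<in> nonvanishing_set X \<O> res e \<longleftrightarrow> x \<in> A" if "x \<in> ?T" for x
    using nonvanishing_idempotent_iff[OF eB that] 0[of x] 1[of x] stalk_zero_neq_one[OF that] that
    by (auto simp: B_def)
  then have "nonvanishing_set X \<O> res e = A" using A(3) nonvanishing_subset by blast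
  then show ?thesis using eB by blast
qed

end

theorem lemma3p7:
  fixes X :: "'x topology"
    and \<O> :: "'x set \<Rightarrow> 'a ring"
    and res :: "'x set \<Rightarrow> 'x set \<Rightarrow> 'a \<Rightarrow> 'a"
  assumes "locally_ringed_space X \<O> res"
  shows "(\<lambda>s. nonvanishing_set X \<O> res s)
    \<in> ring_iso (idempotent_ring (\<O> (topspace X))) (clopen_ring X)"
proof -
  interpret locally_ringed_space X \<O> res by fact
  show ?thesis
  proof (rule ring_iso_memI)
    show "bij_betw (\<lambda>s. nonvanishing_set X \<O> res s)
        (carrier (idempotent_ring (\<O> (topspace X)))) (carrier (clopen_ring X))"
      using nonvanishing_inj nonvanishing_idempotent_clopen nonvanishing_surj
      by (auto simp: bij_betw_def image_iff)
    show "nonvanishing_set X \<O> res \<one>\<^bsub>idempotent_ring (\<O> (topspace X))\<^esub> = \<one>\<^bsub>clopen_ring X\<^esub>"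
      using nonvanishing_one by (simp add: idempotent_ring_def clopen_ring_def)
  qed (simp_all add: nonvanishing_idempotent_clopen nonvanishing_mult nonvanishing_add,
       simp_all add: clopen_ring_def)
qed

end
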